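(* Let $n,s\ge 2$ be integers and $q\ge0$ a real number. Fix positive reals $\alpha_1,\dots,\alpha_s$, reals $p_1,\dots,p_s\in(0,1)$, and a set $S$ of positive integers. For $i\in[s]$ let $\mathcal F_i\subset 2^{[n]}$ be such that for any $F_1\in\mathcal F_1,\dots,F_s\in\mathcal F_s$ there exists $\ell\in S$ with $$\sum_{i=1}^s\alpha_i|F_i\cap[\ell]|\ge\ell+q.\qquad( * )$$ Fix a positive real $r$. Then there exist juntas $\mathcal J_1,\dots,\mathcal J_s\subset 2^{[n]}$ with center $[j]$ such that for any $F_1\in\mathcal J_1,\dots,F_s\in\mathcal J_s$ the inequality $( * )$ holds for some $\ell\in S\cap[j]$, and moreover $\mu_{p_i}(\mathcal F_i\setminus\mathcal J_i)\le p_i^r$ for every $i\in[s]$, provided one of the following three conditions holds for some real $\epsilon\in(0,1/3]$: (i) $j:=\max_{i\in[s]}\Big\{\frac{4\sigma}{\epsilon^2p_i}\Big(r\log\frac{\sigma}{(1-\epsilon)p_i}+\log\frac{8}{\epsilon^2}\Big),\ \frac{\sigma r}{\epsilon p_i}\Big\}$ and $n\ge(1-\epsilon)^{-1}\sigma$, where $\sigma:=\sum_{i=1}^s\alpha_ip_i$ and $\sigma\ge p_i$ for every $i$; (ii) $j:=\max_{i\in[s]}\Big\{\frac{4\alpha_is}{\epsilon^2}\Big(r\log\frac{\alpha_is}{1-\epsilon}+\log\frac{8}{\epsilon^2}\Big),\ r\alpha_is\epsilon^{-1}\Big\}$ and $\max_{i\in[s]}\alpha_isp_i\le 1-\epsilon$;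 (iii) for some $C\ge2$, $j:=\max_{i\in[s]}\alpha_irs\log_C(Ce\alpha_is)$ and $\max_{i\in[s]}Ce\alpha_isp_i\le1$.
   Context: All logarithms without a base are natural. $[m]=\{1,\dots,m\}$; for a real $j$, $[j]$ denotes $\{1,\dots,\lfloor j\rfloor\}$. For $F\subset[n]$, $\mu_p(F)=p^{|F|}(1-p)^{n-|F|}$, and for $\mathcal F\subset2^{[n]}$, $\mu_p(\mathcal F)=\sum_{F\in\mathcal F}\mu_p(F)$. A family $\mathcal J\subset2^{[n]}$ is a junta with center $[j]$ if there is $\mathcal J^*\subset2^{[j]}$ with $\mathcal J=\{F\subset[n]: F\cap[j]\in\mathcal J^*\}$.
   Formalization: In condition (i) the requirement n ≥ (1-ε)^{-1}σ is replaced by 1 ≥ (1-ε)^{-1}σ, i.e. σ ≤ 1-ε; as printed the claim fails, e.g. s=2, α_i=1, p_i=1/2, q=0, r=2, ε=1/3, n=468, S={n}, F_i = sets of size at least n/2. *)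

theory Defs
  imports Complex_Main
begin

text \<open>\<open>[x]\<close> for a real \<open>x\<close>; it is empty when \<open>x < 1\<close>, in particular when \<open>x\<close> is negative.\<close>

definition initial_segment :: "real \<Rightarrow> nat set" where
  "initial_segment x = {1..nat \<lfloor>x\<rfloor>}"

definition mu :: "nat \<Rightarrow> real \<Rightarrow> nat set set \<Rightarrow> real" where
  "mu n p \<F> = (\<Sum>F\<in>\<F>. p ^ card F * (1 - p) ^ (n - card F))"

text \<open>The center may exceed the ground set (\<open>j > n\<close>); every family on \<open>[n]\<close> is then a junta.\<close>

definition junta_with_center :: "nat \<Rightarrow> real \<Rightarrow> nat set set \<Rightarrow> bool" where
  "junta_with_center n j \<J> \<longleftrightarrow>
     (\<exists>\<J>' \<subseteq> Pow (initial_segment j).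
        \<J> = {F. F \<subseteq> {1..n} \<and> F \<inter> initial_segment j \<in> \<J>'})"

definition cross_condition ::
    "nat \<Rightarrow> (nat \<Rightarrow> real) \<Rightarrow> real \<Rightarrow> nat set \<Rightarrow> (nat \<Rightarrow> nat set set) \<Rightarrow> bool" where
  "cross_condition s \<alpha> q S \<F> \<longleftrightarrow>
     (\<forall>F. (\<forall>i\<in>{1..s}. F i \<in> \<F> i) \<longrightarrow>
        (\<exists>l\<in>S. (\<Sum>i=1..s. \<alpha> i * real (card (F i \<inter> {1..l}))) \<ge> real l + q))"

end

theory Submission
  imports Defs
begin

text \<open>Choose \<open>a\<^sub>i > 0\<close> with \<open>\<Sum>\<^sub>i \<alpha>\<^sub>i / a\<^sub>i = 1\<close>: \<open>a\<^sub>i = \<sigma> / p\<^sub>i\<close> under (i) and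
  \<open>a\<^sub>i = \<alpha>\<^sub>i s\<close> under (ii) and (iii). Call \<open>F\<close> dense if \<open>|F \<inter> [l]| \<ge> l / a\<^sub>i\<close> for some
  \<open>l > j\<close>, and let \<open>\<J>\<^sub>i\<close> consist of the sets that agree on \<open>[j]\<close> with a member of \<open>\<F>\<^sub>i\<close> that is
  not dense. Members of \<open>\<F>\<^sub>i\<close> that are not dense satisfy the required inequality only for
  \<open>l \<le> j\<close>, where it depends on their traces on \<open>[j]\<close> alone. With \<open>y = a p < 1\<close>, the process
  \<open>y powr - |F \<inter> [l]| * exp (- p (1 / y - 1) l)\<close> is a supermartingale in \<open>l\<close> started at 1, so the maximal
  inequality bounds the measure of the dense sets by \<open>exp (- (j / a) (y - 1 - ln y))\<close>; no union
  bound over \<open>l\<close> is needed. The choice of \<open>j\<close> makes this at most \<open>p powr r\<close>.\<close>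

section \<open>Supermartingales and the maximal inequality for the product measure\<close>

lemma sum_Pow_Suc:
  fixes f :: "nat set \<Rightarrow> 'a::comm_monoid_add"
  shows "(\<Sum>F\<in>Pow {1..Suc n}. f F) = (\<Sum>F\<in>Pow {1..n}. f F + f (insert (Suc n) F))"
proof -
  have "Pow {1..Suc n} = Pow {1..n} \<union> insert (Suc n) ` Pow {1..n}"
    by (simp add: atLeastAtMostSuc_conv Pow_insert)
  moreover have "Pow {1..n} \<inter> insert (Suc n) ` Pow {1..n} = {}"
    by auto
  moreover have "inj_on (insert (Suc n)) (Pow {1..n})"
    by (auto simp: inj_on_def dest!: insert_ident[THEN iffD1, rotated 2])
  ultimately show ?thesis
    by (simp add: sum.union_disjoint sum.reindex sum.distrib)
qed

text \<open>For a \<open>p\<close>-random set \<open>F\<close>, the step from \<open>l\<close> to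
  \<open>l + 1\<close> multiplies this by \<open>b * c\<close> with probability \<open>p\<close> and
  by \<open>c\<close> otherwise; \<open>super\<close> below bounds the mean of that factor by
  1.\<close>

definition exp_process :: "real \<Rightarrow> real \<Rightarrow> nat set \<Rightarrow> nat \<Rightarrow> real" where
  "exp_process b c F l = b ^ card (F \<inter> {1..l}) * c ^ l"

context
  fixes p b c A :: real
  assumes p: "0 < p" "p < 1" and b: "0 \<le> b" and c: "0 \<le> c"
    and super: "(1 - p + p * b) * c \<le> 1"
begin

text \<open>Induction on \<open>n\<close>, pairing \<open>F\<close> with
  \<open>insert (Suc n) F\<close>: a value frozen at \<open>A\<close> stays, and a running one has
  its mean multiplied by \<open>(1 - p + p * b) * c\<close>.\<close>

lemma stopped_supermartingale:
  "(\<Sum>F\<in>Pow {1..n}. p ^ card F * (1 - p) ^ (n - card F) *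
      (if \<exists>l\<le>n. A \<le> exp_process b c F l then A else exp_process b c F n)) \<le> 1"
proof (induction n)
  case 0
  have "Pow {1..0 :: nat} = {{}}" by auto
  then show ?case by (simp only: sum.insert[OF finite.emptyI] sum.empty empty_iff) (simp add: exp_process_def)
next
  case (Suc n)
  let ?w = "\<lambda>n F. p ^ card F * (1 - p) ^ (n - card F)"
  let ?Z = "\<lambda>n F. if \<exists>l\<le>n. A \<le> exp_process b c F l then A else exp_process b c F n"
  have "?w (Suc n) F * ?Z (Suc n) F + ?w (Suc n) (insert (Suc n) F) * ?Z (Suc n) (insert (Suc n) F)
      \<le> ?w n F * ?Z n F" if "F \<in> Pow {1..n}" for F
  proof -
    let ?F' = "insert (Suc n) F"
    have F: "F \<subseteq> {1..n}" and fin: "finite F" and notin: "Suc n \<notin> F"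
      using that by (auto intro: finite_subset)
    have le: "card F \<le> n"
      using card_mono[OF _ F] by simp
    have w: "?w (Suc n) F = (1 - p) * ?w n F" "?w (Suc n) ?F' = p * ?w n F"
      using le fin notin by (simp_all add: Suc_diff_le)
    have MF': "exp_process b c ?F' l = exp_process b c F l" if "l \<le> n" for l
      using that by (simp add: exp_process_def)
    have int: "F \<inter> {1..Suc n} = F" "F \<inter> {1..n} = F" "?F' \<inter> {1..Suc n} = ?F'"
      using F by auto
    have step: "exp_process b c F (Suc n) = c * exp_process b c F n" "exp_process b c ?F' (Suc n) = b * c * exp_process b c F n"
      unfolding exp_process_def int using fin notin by simp_all
    have M0: "0 \<le> exp_process b c F n"
      using b c by (simp add: exp_process_def)
    have "(1 - p) * ?Z (Suc n) F + p * ?Z (Suc n) ?F' \<le> ?Z n F"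
    proof (cases "\<exists>l\<le>n. A \<le> exp_process b c F l")
      case True
      then have "?Z n F = A" "?Z (Suc n) F = A" "?Z (Suc n) ?F' = A"
        using MF' le_Suc_eq by auto
      then show ?thesis by (simp add: algebra_simps)
    next
      case False
      then have "?Z (Suc n) F \<le> c * exp_process b c F n" "?Z (Suc n) ?F' \<le> b * c * exp_process b c F n" "?Z n F = exp_process b c F n"
        using MF' step by (auto simp: le_Suc_eq)
      moreover from this have "(1 - p) * ?Z (Suc n) F + p * ?Z (Suc n) ?F'
          \<le> (1 - p) * (c * exp_process b c F n) + p * (b * c * exp_process b c F n)"
        using p by (intro add_mono mult_left_mono) auto
      moreover have "\<dots> = (1 - p + p * b) * c * exp_process b c F n"
        by (simp add: algebra_simps)
      moreover have "\<dots> \<le> exp_process b c F n"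
        using mult_right_mono[OF super M0] by simp
      ultimately show ?thesis by linarith
    qed
    moreover have "0 \<le> ?w n F"
      using p by simp
    ultimately have "?w n F * ((1 - p) * ?Z (Suc n) F + p * ?Z (Suc n) ?F') \<le> ?w n F * ?Z n F"
      by (rule mult_left_mono)
    then show ?thesis
      unfolding w by (simp only: distrib_left mult_ac)
  qed
  then have "(\<Sum>F\<in>Pow {1..Suc n}. ?w (Suc n) F * ?Z (Suc n) F) \<le> (\<Sum>F\<in>Pow {1..n}. ?w n F * ?Z n F)"
    unfolding sum_Pow_Suc by (rule sum_mono)
  then show ?case using Suc.IH by (rule order_trans)
qed

text \<open>Markov's inequality for the stopped value, which is \<open>A\<close> on the sets that
  reached the level and nonnegative on the others.\<close>

lemma maximal_inequality:
  assumes "0 < A"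
  shows "mu n p {F. F \<subseteq> {1..n} \<and> (\<exists>l\<le>n. A \<le> exp_process b c F l)} \<le> 1 / A"
proof -
  let ?w = "\<lambda>F. p ^ card F * (1 - p) ^ (n - card F)"
  let ?Z = "\<lambda>F. if \<exists>l\<le>n. A \<le> exp_process b c F l then A else exp_process b c F n"
  let ?B = "{F. F \<subseteq> {1..n} \<and> (\<exists>l\<le>n. A \<le> exp_process b c F l)}"
  have "mu n p ?B * A = (\<Sum>F\<in>?B. ?w F * ?Z F)"
    by (auto simp: mu_def sum_distrib_right intro!: sum.cong)
  also have "\<dots> \<le> (\<Sum>F\<in>Pow {1..n}. ?w F * ?Z F)"
  proof (rule sum_mono2)
    fix F
    have "0 \<le> exp_process b c F n" using b c by (simp add: exp_process_def)
    then show "0 \<le> ?w F * ?Z F" using p assms by simp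
  qed auto
  also have "\<dots> \<le> 1" by (rule stopped_supermartingale)
  finally show ?thesis using assms by (simp add: field_simps)
qed

end

section \<open>The measure of the dense sets\<close>

lemma mu_mono:
  assumes "0 < p" "p < 1" "\<A> \<subseteq> \<B>" "\<B> \<subseteq> Pow {1..n}"
  shows "mu n p \<A> \<le> mu n p \<B>"
  unfolding mu_def using assms by (intro sum_mono2) (auto intro: finite_subset)

text \<open>\<open>l\<close> is not bounded by \<open>n\<close>, since \<open>S\<close> may contain
  larger elements. Requiring \<open>l \<ge> 1\<close> matters when \<open>j\<close> is negative, as
  it can be under (iii): \<open>l = 0\<close> would make every set dense.\<close>

definition dense_sets :: "nat \<Rightarrow> real \<Rightarrow> real \<Rightarrow> nat set set" where
  "dense_sets n j a =
     {F. F \<subseteq> {1..n} \<and> (\<exists>l\<ge>1. j < real l \<and> real l \<le> a * real (card (F \<inter> {1..l})))}"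

text \<open>Holds because \<open>card (F \<inter> {1..l}) \<le> l\<close>. It disposes of
  \<open>a < 1\<close>, where the exponent estimates below, which assume \<open>1 \<le> a\<close>,
  do not apply.\<close>

lemma dense_sets_empty:
  assumes "a < 1"
  shows "dense_sets n j a = {}"
proof -
  have False if "1 \<le> l" "real l \<le> a * real (card (F \<inter> {1..l}))" for l F
  proof -
    have le: "card (F \<inter> {1..l}) \<le> l"
      using card_mono[of "{1..l}" "F \<inter> {1..l}"] by simp
    show False
    proof (cases "card (F \<inter> {1..l}) = 0")
      case True
      then show ?thesis using that by simp
    next
      case False
      then have "0 < real (card (F \<inter> {1..l}))"
        by linarith
      then have "a * real (card (F \<inter> {1..l})) < real (card (F \<inter> {1..l}))"
        using assms mult_strict_right_mono[of a 1] by force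
      then show ?thesis using that le by linarith
    qed
  qed
  then show ?thesis unfolding dense_sets_def by blast
qed

lemma mu_dense_sets:
  assumes p: "0 < p" "p < 1" and a: "0 < a" and y: "a * p < 1"
  shows "mu n p (dense_sets n j a) \<le> exp (- (j / a * (a * p - 1 - ln (a * p))))"
proof -
  define h where "h = a * p - 1 - ln (a * p)"
  \<comment> \<open>Chernoff's choice: \<open>b\<close> maximises
    \<open>ln b / a - p * (b - 1)\<close>, the exponent gained per unit of \<open>l\<close> at
    density \<open>1 / a\<close>; the maximum is \<open>h / a\<close>. The value of \<open>c\<close>
    gives \<open>super\<close> through \<open>1 + x \<le> exp x\<close>.\<close>
  define b where "b = 1 / (a * p)"
  define c where "c = exp (- (p * (b - 1)))"
  have ap: "0 < a * p" using p a by simp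
  have h0: "0 \<le> h" using ln_le_minus_one[OF ap] by (simp add: h_def)
  have b1: "1 < b" using ap y by (simp add: b_def)
  have pb: "p * b = 1 / a" using p by (simp add: b_def)
  have c1: "0 < c" "c \<le> 1" using p b1 by (auto simp: c_def)
  have "(1 - p + p * b) \<le> exp (p * (b - 1))"
    using exp_ge_add_one_self[of "p * (b - 1)"] by (simp add: algebra_simps)
  then have super: "(1 - p + p * b) * c \<le> 1"
    by (simp add: c_def exp_minus divide_inverse[symmetric])
  have b_eq: "b = exp (- ln (a * p))"
    using ap by (simp add: b_def exp_minus inverse_eq_divide)
  have "\<exists>m\<le>n. exp (j / a * h) \<le> exp_process b c F m"
    if F: "F \<subseteq> {1..n}" and l: "j < real l" "real l \<le> a * real (card (F \<inter> {1..l}))" for F l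
  proof -
    \<comment> \<open>The maximal inequality sees only times up to \<open>n\<close>. For
      \<open>l > n\<close> the count is that at \<open>n\<close>, and going back to
      \<open>min l n\<close> does not lower the process because \<open>c \<le> 1\<close>.\<close>
    have eq: "F \<inter> {1..l} = F \<inter> {1..min l n}" using F by auto
    let ?k = "card (F \<inter> {1..l})"
    have "j / a * h \<le> real l / a * h"
      using l a h0 by (intro mult_right_mono divide_right_mono) auto
    also have "\<dots> = - ln (a * p) * (real l / a) - real l * (p * (b - 1))"
      using a by (simp add: h_def pb right_diff_distrib)
    also have "\<dots> \<le> - ln (a * p) * real ?k - real l * (p * (b - 1))"
    proof -
      have "real l / a \<le> real ?k" using l a by (simp add: field_simps)
      moreover have "0 \<le> - ln (a * p)" using ap y by simp
      ultimately show ?thesis by (intro diff_right_mono mult_left_mono)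
    qed
    finally have "exp (j / a * h) \<le> exp (- ln (a * p) * real ?k - real l * (p * (b - 1)))"
      by simp
    also have "\<dots> = b ^ ?k * c ^ l"
      unfolding diff_conv_add_uminus exp_add b_eq[symmetric]
      by (subst b_eq) (simp add: c_def exp_of_nat_mult[symmetric] mult.commute)
    also have "\<dots> \<le> b ^ ?k * c ^ min l n"
      using c1 b1 by (intro mult_left_mono power_decreasing) auto
    finally show ?thesis
      by (intro exI[of _ "min l n"]) (auto simp only: exp_process_def eq[symmetric])
  qed
  then have "dense_sets n j a \<subseteq> {F. F \<subseteq> {1..n} \<and> (\<exists>m\<le>n. exp (j / a * h) \<le> exp_process b c F m)}"
    unfolding dense_sets_def by blast
  then have "mu n p (dense_sets n j a)
      \<le> mu n p {F. F \<subseteq> {1..n} \<and> (\<exists>m\<le>n. exp (j / a * h) \<le> exp_process b c F m)}"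
    using p by (intro mu_mono) auto
  also have "\<dots> \<le> 1 / exp (j / a * h)"
    using maximal_inequality[OF p _ _ super] b1 c1 by simp
  finally show ?thesis
    by (simp add: h_def exp_minus inverse_eq_divide)
qed

text \<open>The left side of the condition on \<open>j\<close> is \<open>- r * ln p\<close>, written
  through \<open>a\<close> and \<open>a * p\<close> to match the exponent lemmas below.\<close>

lemma mu_dense_sets_le_powr:
  assumes p: "0 < p" "p < 1" and a: "0 < a" and y: "a * p < 1"
    and j: "1 \<le> a \<Longrightarrow> r * (ln a - ln (a * p)) \<le> j / a * (a * p - 1 - ln (a * p))"
  shows "mu n p (dense_sets n j a) \<le> p powr r"
proof (cases "1 \<le> a")
  case True
  have "mu n p (dense_sets n j a) \<le> exp (- (j / a * (a * p - 1 - ln (a * p))))"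
    by (rule mu_dense_sets[OF p a y])
  also have "\<dots> \<le> exp (r * ln p)"
    using j[OF True] p a by (simp add: ln_mult)
  finally show ?thesis using p by (simp add: powr_def)
next
  case False
  then show ?thesis by (simp add: dense_sets_empty mu_def)
qed

section \<open>Elementary inequalities behind the choice of \<open>j\<close>\<close>

text \<open>Applying \<open>ln x \<le> x - 1\<close> to a square root of
  \<open>1 - \<epsilon>\<close>, bounded by its second-order Taylor polynomial \<open>?u\<close>,
  gains the quadratic term that matches the factor \<open>4 / \<epsilon>\<^sup>2\<close> in
  \<open>j\<close>.\<close>

lemma ln_one_minus_le:
  fixes \<epsilon> :: real
  assumes "0 < \<epsilon>" "\<epsilon> < 1"
  shows "ln (1 - \<epsilon>) \<le> - \<epsilon> - \<epsilon>\<^sup>2 / 4"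
proof -
  let ?u = "1 - \<epsilon> / 2 - \<epsilon>\<^sup>2 / 8"
  have "\<epsilon>\<^sup>2 < 1" using assms by (simp add: power_less_one_iff)
  then have u: "0 < ?u" using assms by linarith
  have "?u\<^sup>2 = 1 - \<epsilon> + \<epsilon> ^ 3 / 8 + \<epsilon> ^ 4 / 64"
    by (simp add: power2_eq_square power3_eq_cube power4_eq_xxxx field_simps)
  then have "1 - \<epsilon> \<le> ?u\<^sup>2" using assms by simp
  then have "ln (1 - \<epsilon>) \<le> ln (?u\<^sup>2)" using assms by (intro ln_mono) auto
  also have "\<dots> = 2 * ln ?u" using u by (simp add: ln_realpow)
  also have "\<dots> \<le> 2 * (?u - 1)" using ln_le_minus_one[OF u] by simp
  finally show ?thesis by simp
qed

text \<open>\<open>- ln y\<close> is split at \<open>y = 1 - \<epsilon>\<close> into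
  \<open>- ln (1 - \<epsilon>)\<close> and the excess \<open>L\<close>. The right side is at least
  \<open>J * (\<epsilon>\<^sup>2 / 4 + \<epsilon> * L)\<close>; its first part pays for
  \<open>r * (ln a - ln (1 - \<epsilon>))\<close> by \<open>J1\<close>, its second for
  \<open>r * L\<close> by \<open>J2\<close>.\<close>

lemma exponent_bound_eps:
  fixes a y r J \<epsilon> :: real
  assumes eps: "0 < \<epsilon>" "\<epsilon> \<le> 1 / 3" and a: "1 \<le> a" and y: "0 < y" "y \<le> 1 - \<epsilon>" and r: "0 < r"
    and J1: "4 / \<epsilon>\<^sup>2 * (r * ln (a / (1 - \<epsilon>)) + ln (8 / \<epsilon>\<^sup>2)) \<le> J" and J2: "r / \<epsilon> \<le> J"
  shows "r * (ln a - ln y) \<le> J * (y - 1 - ln y)"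
proof -
  define L where "L = ln ((1 - \<epsilon>) / y)"
  have lny: "ln y = ln (1 - \<epsilon>) - L" using eps y by (simp add: L_def ln_div)
  have L0: "0 \<le> L" using eps y by (simp add: L_def)
  have la: "ln (a / (1 - \<epsilon>)) = ln a - ln (1 - \<epsilon>)" "0 \<le> ln a - ln (1 - \<epsilon>)"
    using a eps by (simp_all add: ln_div add_nonneg_nonneg)
  have "\<epsilon>\<^sup>2 \<le> 1" using eps by (simp add: power_le_one)
  then have "0 \<le> ln (8 / \<epsilon>\<^sup>2)" using eps by simp
  then have "4 / \<epsilon>\<^sup>2 * (r * (ln a - ln (1 - \<epsilon>))) \<le> 4 / \<epsilon>\<^sup>2 * (r * ln (a / (1 - \<epsilon>)) + ln (8 / \<epsilon>\<^sup>2))"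
    unfolding la by (intro mult_left_mono) auto
  also note J1
  finally have J1': "r * (ln a - ln (1 - \<epsilon>)) \<le> J * (\<epsilon>\<^sup>2 / 4)"
    using eps by (simp add: field_simps)
  have J0: "0 \<le> J" using J2 r eps by (smt (verit) divide_pos_pos)
  \<comment> \<open>convexity of \<open>L \<mapsto> L - 1 + exp (- L)\<close>, whose slope at \<open>- ln (1 - \<epsilon>)\<close> is \<open>\<epsilon>\<close>\<close>
  have "y / (1 - \<epsilon>) \<ge> 1 - L"
    using exp_ge_add_one_self[of "- L"] eps y by (simp add: L_def exp_minus)
  then have "y \<ge> (1 - \<epsilon>) * (1 - L)" using eps by (simp add: field_simps)
  then have "\<epsilon>\<^sup>2 / 4 + \<epsilon> * L \<le> y - 1 - ln y"
    using ln_one_minus_le[of \<epsilon>] eps by (simp add: lny algebra_simps)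
  then have "J * (\<epsilon>\<^sup>2 / 4 + \<epsilon> * L) \<le> J * (y - 1 - ln y)"
    using J0 by (rule mult_left_mono)
  moreover have "r * L \<le> J * (\<epsilon> * L)"
    using mult_right_mono[OF _ L0, of r "J * \<epsilon>"] J2 eps by (simp add: field_simps)
  moreover have "r * (ln a - ln y) = r * (ln a - ln (1 - \<epsilon>)) + r * L"
    by (simp add: lny algebra_simps)
  ultimately show ?thesis using J1' by (simp add: distrib_left)
qed

text \<open>With \<open>u = - ln y - 1\<close> the left side is \<open>r * ((ln a + 1) + u)\<close>.
  Since \<open>ln C \<le> u\<close>, the bracket is at most
  \<open>((ln a + 1) / ln C + 1) * u\<close>, whose first factor is the logarithm in
  \<open>J\<close>.\<close>

lemma exponent_bound_log:
  fixes a y r J C :: real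
  assumes C: "1 < C" and a: "1 \<le> a" and y: "0 < y" "C * exp 1 * y \<le> 1" and r: "0 < r"
    and J: "r * log C (C * exp 1 * a) \<le> J"
  shows "r * (ln a - ln y) \<le> J * (y - 1 - ln y)"
proof -
  define u where "u = - ln y - 1"
  have c0: "0 < ln C" using C by simp
  have a0: "0 \<le> ln a" using a by simp
  have "ln (C * exp 1 * y) \<le> 0" using y C by simp
  then have u: "ln C \<le> u" using y C by (simp add: u_def ln_mult)
  have log: "log C (C * exp 1 * a) = (ln a + 1) / ln C + 1"
    using C a by (simp add: log_def ln_mult field_simps)
  have J0: "0 \<le> J"
  proof -
    have "0 \<le> r * log C (C * exp 1 * a)" unfolding log using r c0 a0 by simp
    then show ?thesis using J by simp
  qed
  have "ln a + 1 \<le> (ln a + 1) / ln C * u"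
    using mult_left_mono[OF u, of "ln a + 1"] a0 c0 by (simp add: field_simps)
  then have "ln a - ln y \<le> log C (C * exp 1 * a) * u"
    unfolding log by (simp add: u_def distrib_right)
  then have "r * (ln a - ln y) \<le> r * log C (C * exp 1 * a) * u"
    using r by (simp add: mult.assoc)
  also have "\<dots> \<le> J * u" using J u c0 by (intro mult_right_mono) auto
  also have "\<dots> \<le> J * (y - 1 - ln y)" using J0 y by (intro mult_left_mono) (auto simp: u_def)
  finally show ?thesis .
qed

section \<open>From the measure of dense sets to juntas\<close>

lemma mem_initial_segment: "l \<in> initial_segment x \<longleftrightarrow> 1 \<le> l \<and> real l \<le> x"
proof -
  have "l \<le> nat \<lfloor>x\<rfloor> \<longleftrightarrow> real l \<le> x" if "1 \<le> l"
    using that le_nat_floor[of l x] of_nat_floor[of x] by (cases "0 \<le> x") linarith+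
  then show ?thesis by (auto simp: initial_segment_def)
qed

lemma juntas_from_dense_sets:
  fixes \<alpha> a :: "nat \<Rightarrow> real"
  assumes s: "s \<ge> 1" and q: "q \<ge> 0"
    and \<alpha>: "\<forall>i\<in>{1..s}. \<alpha> i > 0" and a: "\<forall>i\<in>{1..s}. a i > 0"
    and sum: "(\<Sum>i=1..s. \<alpha> i / a i) \<le> 1"
    and p: "\<forall>i\<in>{1..s}. 0 < p i \<and> p i < 1"
    and S: "\<forall>l\<in>S. l > 0"
    and \<F>: "\<forall>i\<in>{1..s}. \<F> i \<subseteq> Pow {1..n}"
    and cross: "cross_condition s \<alpha> q S \<F>"
    and dense: "\<forall>i\<in>{1..s}. mu n (p i) (dense_sets n j (a i)) \<le> p i powr r"
  shows "\<exists>\<J> :: nat \<Rightarrow> nat set set.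
           (\<forall>i\<in>{1..s}. junta_with_center n j (\<J> i))
         \<and> cross_condition s \<alpha> q (S \<inter> initial_segment j) \<J>
         \<and> (\<forall>i\<in>{1..s}. mu n (p i) (\<F> i - \<J> i) \<le> p i powr r)"
proof -
  define T where "T i = (\<lambda>G. G \<inter> initial_segment j) ` (\<F> i - dense_sets n j (a i))" for i
  define \<J> where "\<J> i = {F. F \<subseteq> {1..n} \<and> F \<inter> initial_segment j \<in> T i}" for i
  have "junta_with_center n j (\<J> i)" for i
    unfolding junta_with_center_def by (intro exI[of _ "T i"]) (auto simp: T_def \<J>_def)
  moreover have "cross_condition s \<alpha> q (S \<inter> initial_segment j) \<J>"
    unfolding cross_condition_def
  proof (intro allI impI)
    fix F assume F: "\<forall>i\<in>{1..s}. F i \<in> \<J> i"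
    have "\<forall>i\<in>{1..s}. \<exists>G. G \<in> \<F> i \<and> G \<notin> dense_sets n j (a i) \<and>
        F i \<inter> initial_segment j = G \<inter> initial_segment j"
      using F unfolding \<J>_def T_def by blast
    then obtain G where G: "\<And>i. i \<in> {1..s} \<Longrightarrow> G i \<in> \<F> i \<and> G i \<notin> dense_sets n j (a i) \<and>
        F i \<inter> initial_segment j = G i \<inter> initial_segment j"
      by metis
    then obtain l where l: "l \<in> S" "(\<Sum>i=1..s. \<alpha> i * real (card (G i \<inter> {1..l}))) \<ge> real l + q"
      using cross unfolding cross_condition_def by blast
    have l1: "1 \<le> l" using S l by force
    have "real l \<le> j"
    proof (rule ccontr)
      \<comment> \<open>Beyond \<open>j\<close> each \<open>G i\<close> has density below
        \<open>1 / a i\<close> on \<open>{1..l}\<close>, so the weighted sum is below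
        \<open>l * (\<Sum>i=1..s. \<alpha> i / a i) \<le> l\<close>, against
        \<open>q \<ge> 0\<close>.\<close>
      assume "\<not> real l \<le> j"
      have lt: "\<alpha> i * real (card (G i \<inter> {1..l})) < \<alpha> i / a i * real l" if i: "i \<in> {1..s}" for i
      proof -
        have "G i \<subseteq> {1..n}" using G[OF i] \<F> i by blast
        then have "a i * real (card (G i \<inter> {1..l})) < real l"
          using G[OF i] l1 \<open>\<not> real l \<le> j\<close> unfolding dense_sets_def by force
        then show ?thesis using \<alpha> a i by (simp add: field_simps)
      qed
      have "(\<Sum>i=1..s. \<alpha> i * real (card (G i \<inter> {1..l}))) < (\<Sum>i=1..s. \<alpha> i / a i * real l)"
        using s lt by (intro sum_strict_mono) auto
      also have "\<dots> \<le> real l"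
        using mult_right_mono[OF sum, of "real l"] by (simp add: sum_distrib_right)
      finally show False using l q by simp
    qed
    then have lj: "l \<in> initial_segment j" using l1 by (simp add: mem_initial_segment)
    \<comment> \<open>The sum at \<open>l\<close> now depends only on traces on \<open>[j]\<close>,
      which \<open>F\<close> and \<open>G\<close> share.\<close>
    then have "{1..l} \<subseteq> initial_segment j" by (auto simp: mem_initial_segment)
    then have "F i \<inter> {1..l} = G i \<inter> {1..l}" if "i \<in> {1..s}" for i
      using G[OF that] by blast
    then have "(\<Sum>i=1..s. \<alpha> i * real (card (F i \<inter> {1..l}))) \<ge> real l + q"
      using l by simp
    then show "\<exists>l\<in>S \<inter> initial_segment j. (\<Sum>i=1..s. \<alpha> i * real (card (F i \<inter> {1..l}))) \<ge> real l + q"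
      using l lj by blast
  qed
  moreover have "mu n (p i) (\<F> i - \<J> i) \<le> p i powr r" if i: "i \<in> {1..s}" for i
  proof -
    \<comment> \<open>A member of \<open>\<F> i\<close> that is not dense puts its own trace into
      \<open>T i\<close>, hence lies in \<open>\<J> i\<close>.\<close>
    have "\<F> i - \<J> i \<subseteq> dense_sets n j (a i)"
      using \<F> i unfolding \<J>_def T_def by blast
    then have "mu n (p i) (\<F> i - \<J> i) \<le> mu n (p i) (dense_sets n j (a i))"
      using p i by (intro mu_mono) (auto simp: dense_sets_def)
    then show ?thesis using dense i by force
  qed
  ultimately show ?thesis by blast
qed

section \<open>The three conditions on \<open>j\<close>\<close>

theorem theorem3p2:
  fixes n s :: nat and q r \<epsilon> j :: real
    and \<alpha> p :: "nat \<Rightarrow> real" and S :: "nat set" and \<F> :: "nat \<Rightarrow> nat set set"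
  assumes "n \<ge> 2" and "s \<ge> 2" and "q \<ge> 0"
    and "\<forall>i\<in>{1..s}. \<alpha> i > 0"
    and "\<forall>i\<in>{1..s}. 0 < p i \<and> p i < 1"
    and "\<forall>l\<in>S. l > 0"
    and "\<forall>i\<in>{1..s}. \<F> i \<subseteq> Pow {1..n}"
    and "cross_condition s \<alpha> q S \<F>"
    and "r > 0"
    and "0 < \<epsilon>" and "\<epsilon> \<le> 1 / 3"
    and "(let \<sigma> = (\<Sum>i=1..s. \<alpha> i * p i) in
            j = (MAX i\<in>{1..s}. max
                  (4 * \<sigma> / (\<epsilon>\<^sup>2 * p i) * (r * ln (\<sigma> / ((1 - \<epsilon>) * p i)) + ln (8 / \<epsilon>\<^sup>2)))
                  (\<sigma> * r / (\<epsilon> * p i)))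
            \<and> 1 \<ge> inverse (1 - \<epsilon>) * \<sigma>
            \<and> (\<forall>i\<in>{1..s}. \<sigma> \<ge> p i))
       \<or> (j = (MAX i\<in>{1..s}. max
                  (4 * \<alpha> i * real s / \<epsilon>\<^sup>2 * (r * ln (\<alpha> i * real s / (1 - \<epsilon>)) + ln (8 / \<epsilon>\<^sup>2)))
                  (r * \<alpha> i * real s * inverse \<epsilon>))
            \<and> (MAX i\<in>{1..s}. \<alpha> i * real s * p i) \<le> 1 - \<epsilon>)
       \<or> (\<exists>C::real. C \<ge> 2
            \<and> j = (MAX i\<in>{1..s}. \<alpha> i * r * real s * log C (C * exp 1 * \<alpha> i * real s))
            \<and> (MAX i\<in>{1..s}. C * exp 1 * \<alpha> i * real s * p i) \<le> 1)"
  shows "\<exists>\<J> :: nat \<Rightarrow> nat set set.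
           (\<forall>i\<in>{1..s}. junta_with_center n j (\<J> i))
         \<and> cross_condition s \<alpha> q (S \<inter> initial_segment j) \<J>
         \<and> (\<forall>i\<in>{1..s}. mu n (p i) (\<F> i - \<J> i) \<le> p i powr r)"
proof -
  define \<sigma> where "\<sigma> = (\<Sum>i=1..s. \<alpha> i * p i)"
  have \<alpha>: "\<And>i. i \<in> {1..s} \<Longrightarrow> \<alpha> i > 0" and p: "\<And>i. i \<in> {1..s} \<Longrightarrow> 0 < p i \<and> p i < 1"
    using assms by blast+
  have s: "1 \<le> s" "0 < real s" using \<open>s \<ge> 2\<close> by simp_all
  have Max_le: "f i \<le> x" if "i \<in> {1..s}" "(MAX i\<in>{1..s}. f i) \<le> x" for f :: "nat \<Rightarrow> real" and i x
    using that by (meson Max_ge finite_atLeastAtMost finite_imageI imageI order_trans)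
  \<comment> \<open>Conditions (i) and (ii) prescribe the same \<open>j\<close> once it is written
    in terms of \<open>a\<close>, so they share this estimate, with
    \<open>J = j / a i\<close>.\<close>
  have eps_dense: "mu n (p i) (dense_sets n j (a i)) \<le> p i powr r"
    if i: "i \<in> {1..s}" and a: "0 < a i" and y: "a i * p i \<le> 1 - \<epsilon>"
      and j: "j = (MAX i\<in>{1..s}. max
                  (4 * a i / \<epsilon>\<^sup>2 * (r * ln (a i / (1 - \<epsilon>)) + ln (8 / \<epsilon>\<^sup>2))) (r * a i / \<epsilon>))"
    for a i
  proof (rule mu_dense_sets_le_powr)
    have "max (4 * a i / \<epsilon>\<^sup>2 * (r * ln (a i / (1 - \<epsilon>)) + ln (8 / \<epsilon>\<^sup>2))) (r * a i / \<epsilon>) \<le> j"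
      using Max_le[OF i eq_refl[OF j[symmetric]]] .
    then have "4 / \<epsilon>\<^sup>2 * (r * ln (a i / (1 - \<epsilon>)) + ln (8 / \<epsilon>\<^sup>2)) \<le> j / a i" "r / \<epsilon> \<le> j / a i"
      using a by (simp_all add: pos_le_divide_eq mult_ac)
    then show "r * (ln (a i) - ln (a i * p i)) \<le> j / a i * (a i * p i - 1 - ln (a i * p i))"
      if "1 \<le> a i"
      using a p[OF i]
      by (intro exponent_bound_eps[OF \<open>0 < \<epsilon>\<close> \<open>\<epsilon> \<le> 1 / 3\<close> that _ y \<open>r > 0\<close>]) simp_all
  qed (use a y p[OF i] \<open>0 < \<epsilon>\<close> in auto)
  have sum_s: "(\<Sum>i=1..s. \<alpha> i / (\<alpha> i * real s)) \<le> 1"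
  proof -
    have "(\<Sum>i=1..s. \<alpha> i / (\<alpha> i * real s)) = (\<Sum>i=1..s. 1 / real s)"
      using \<alpha> by (intro sum.cong) (auto simp: less_imp_neq[symmetric])
    then show ?thesis using s by simp
  qed
  have "\<exists>a. (\<forall>i\<in>{1..s}. a i > 0) \<and> (\<Sum>i=1..s. \<alpha> i / a i) \<le> 1 \<and>
      (\<forall>i\<in>{1..s}. mu n (p i) (dense_sets n j (a i)) \<le> p i powr r)"
    using assms(12) unfolding Let_def \<sigma>_def[symmetric]
  proof (elim disjE conjE exE)
    assume j: "j = (MAX i\<in>{1..s}. max
                  (4 * \<sigma> / (\<epsilon>\<^sup>2 * p i) * (r * ln (\<sigma> / ((1 - \<epsilon>) * p i)) + ln (8 / \<epsilon>\<^sup>2)))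
                  (\<sigma> * r / (\<epsilon> * p i)))"
      and \<sigma>1: "1 \<ge> inverse (1 - \<epsilon>) * \<sigma>" and \<sigma>p: "\<forall>i\<in>{1..s}. \<sigma> \<ge> p i"
    have \<sigma>0: "0 < \<sigma>" using p[of 1] \<sigma>p s by force
    have pos: "\<sigma> / p i > 0" if "i \<in> {1..s}" for i using \<sigma>0 p[OF that] by simp
    have sum: "(\<Sum>i=1..s. \<alpha> i / (\<sigma> / p i)) \<le> 1"
      using \<sigma>0 by (simp add: sum_divide_distrib[symmetric] \<sigma>_def)
    \<comment> \<open>Here \<open>a i * p i\<close> is \<open>\<sigma>\<close> for every
      \<open>i\<close>.\<close>
    have le: "\<sigma> / p i * p i \<le> 1 - \<epsilon>" if "i \<in> {1..s}" for i
      using \<sigma>1 p[OF that] \<open>\<epsilon> \<le> 1 / 3\<close> by (simp add: field_simps)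
    have "j = (MAX i\<in>{1..s}. max
        (4 * (\<sigma> / p i) / \<epsilon>\<^sup>2 * (r * ln (\<sigma> / p i / (1 - \<epsilon>)) + ln (8 / \<epsilon>\<^sup>2))) (r * (\<sigma> / p i) / \<epsilon>))"
      unfolding j by (simp add: mult_ac)
    then show ?thesis
      using pos sum eps_dense[of _ "\<lambda>i. \<sigma> / p i"] le by (intro exI[of _ "\<lambda>i. \<sigma> / p i"]) blast
  next
    assume j: "j = (MAX i\<in>{1..s}. max
                  (4 * \<alpha> i * real s / \<epsilon>\<^sup>2 * (r * ln (\<alpha> i * real s / (1 - \<epsilon>)) + ln (8 / \<epsilon>\<^sup>2)))
                  (r * \<alpha> i * real s * inverse \<epsilon>))"
      and y: "(MAX i\<in>{1..s}. \<alpha> i * real s * p i) \<le> 1 - \<epsilon>"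
    have "j = (MAX i\<in>{1..s}. max
        (4 * (\<alpha> i * real s) / \<epsilon>\<^sup>2 * (r * ln (\<alpha> i * real s / (1 - \<epsilon>)) + ln (8 / \<epsilon>\<^sup>2)))
        (r * (\<alpha> i * real s) / \<epsilon>))"
      unfolding j by (simp add: mult_ac divide_inverse)
    then show ?thesis
      using s \<alpha> sum_s eps_dense[of _ "\<lambda>i. \<alpha> i * real s"] Max_le[OF _ y]
      by (intro exI[of _ "\<lambda>i. \<alpha> i * real s"]) (auto simp: mult_pos_pos)
  next
    fix C :: real
    assume C: "C \<ge> 2"
      and j: "j = (MAX i\<in>{1..s}. \<alpha> i * r * real s * log C (C * exp 1 * \<alpha> i * real s))"
      and y: "(MAX i\<in>{1..s}. C * exp 1 * \<alpha> i * real s * p i) \<le> 1"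
    have "mu n (p i) (dense_sets n j (\<alpha> i * real s)) \<le> p i powr r" if i: "i \<in> {1..s}" for i
    proof (rule mu_dense_sets_le_powr)
      let ?a = "\<alpha> i * real s"
      show a: "0 < ?a" using \<alpha>[OF i] s by simp
      then have ap: "0 < ?a * p i" using p[OF i] by simp
      have Cy: "C * exp 1 * (?a * p i) \<le> 1" using Max_le[OF i y] by (simp add: mult_ac)
      have "1 < exp (1 :: real)" by simp
      \<comment> \<open>\<open>C * exp 1 > 1\<close> turns \<open>Cy\<close> into the strict bound
        that the dense-set estimate needs.\<close>
      then have "1 < C * exp 1" using C by (smt (verit) mult_le_cancel_right1)
      then show "?a * p i < 1"
        using Cy ap by (smt (verit) mult_less_cancel_right1)
      have "\<alpha> i * r * real s * log C (C * exp 1 * \<alpha> i * real s) \<le> j"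
        by (rule Max_le[OF i]) (simp add: j)
      then have "r * log C (C * exp 1 * ?a) \<le> j / ?a"
        using a by (simp add: pos_le_divide_eq mult_ac)
      then show "r * (ln ?a - ln (?a * p i)) \<le> j / ?a * (?a * p i - 1 - ln (?a * p i))"
        if "1 \<le> ?a"
        using C by (intro exponent_bound_log[OF _ that ap Cy \<open>r > 0\<close>]) simp_all
    qed (use p[OF i] in auto)
    then show ?thesis
      using s \<alpha> sum_s by (intro exI[of _ "\<lambda>i. \<alpha> i * real s"]) (auto simp: mult_pos_pos)
  qed
  then obtain a where "\<forall>i\<in>{1..s}. a i > 0" "(\<Sum>i=1..s. \<alpha> i / a i) \<le> 1"
      "\<forall>i\<in>{1..s}. mu n (p i) (dense_sets n j (a i)) \<le> p i powr r"
    by blast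
  then show ?thesis
    using juntas_from_dense_sets[OF s(1) assms(3,4) _ _ assms(5-8)] by blast
qed

end
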